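(* Let $p > 1$ and let $\{X_{n,k}, \, 1 \leqslant k \leqslant n, n \geqslant 1\}$ be an array of random variables satisfying $\mathbb{E}|X_{n,k}|^{p} < \infty$ for each $1 \leqslant k \leqslant n$ and all $n \geqslant 1$. Suppose that for some $q > \max\{p,2\}$ and some sequences $\{\beta_{n}\}$, $\{\xi_{n}\}$ of positive numbers, $$\mathbb{E}\left|\sum_{k=1}^{n}\left[g_{t}(X_{n,k}) - \mathbb{E}\, g_{t}(X_{n,k})\right]\right|^{q} \leqslant \beta_{n}\sum_{k=1}^{n}\mathbb{E}\,|g_{t}(X_{n,k})|^{q} + \xi_{n}\left[\sum_{k=1}^{n}\mathbb{E}\,|g_{t}(X_{n,k})|^{2}\right]^{q/2}\quad\text{for all } n \geqslant 1 \text{ and } t > 0.$$ If $\{b_{n}\}$, $\{c_{n}\}$ are real sequences of positive numbers such that (a) $\sum_{n=1}^{\infty}\sum_{k=1}^{n}\beta_{n}c_{n}b_{n}^{-q}\int_{0}^{b_{n}^{q}}\mathbb{P}\{|X_{n,k}|^{q} > t\}\,\mathrm{d}t < \infty$, (b) $\sum_{n=1}^{\infty}\xi_{n}c_{n}b_{n}^{-p}\int_{0}^{b_{n}^{p-q}}\left(\sum_{k=1}^{n}\int_{0}^{t^{2/(p-q)}}\mathbb{P}\{X_{n,k}^{2} > s\}\,\mathrm{d}s\right)^{q/2}\mathrm{d}t < \infty$, (c) $\sum_{n=1}^{\infty}\xi_{n}c_{n}b_{n}^{-q}\left(\sum_{k=1}^{n}\int_{0}^{b_{n}^{2}}\mathbb{P}\{X_{n,k}^{2}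 > t\}\,\mathrm{d}t\right)^{q/2} < \infty$, (d) $\sum_{n=1}^{\infty}\sum_{k=1}^{n}c_{n}\,\mathbb{E}\left[|X_{n,k}| I_{\{|X_{n,k}| > b_{n}\}}\right]/b_{n} < \infty$, (e) $\sum_{n=1}^{\infty}\sum_{k=1}^{n}(1+\beta_{n})c_{n}b_{n}^{-p}\int_{b_{n}^{p}}^{\infty}\mathbb{P}\{|X_{n,k}|^{p} > t\}\,\mathrm{d}t < \infty$, then $$\sum_{n=1}^{\infty}c_{n}\,\mathbb{E}\left[\frac{\left|\sum_{k=1}^{n}(X_{n,k} - \mathbb{E}\,X_{n,k})\right|}{b_{n}} - \varepsilon\right]_{+}^{p} < \infty$$ for all $\varepsilon > 0$.
   Context: Notation: $x_{+} = \max(x,0)$, and $[\,\cdot\,]_{+}^{p}$ means $([\,\cdot\,]_{+})^{p}$ (inside the expectation). $I_{A}$ is the indicator random variable of the event $A$. For $t>0$, $g_{t}(x) = \max(\min(x,t),-t)$ is truncation at level $t$. *)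

theory Defs
  imports "HOL-Probability.Probability"
begin

text \<open>Truncation at level \<open>t > 0\<close>.\<close>

definition trunc :: "real \<Rightarrow> real \<Rightarrow> real" where
  "trunc t x = max (min x t) (- t)"

end

theory Submission
  imports Defs
begin

text \<open>
  Write \<open>S\<close> for the centred row sum and \<open>u = s powr (1 / (p - q))\<close>, so that \<open>u\<close> runs through
  \<open>[b, \<infinity>)\<close> as \<open>s\<close> runs through \<open>{0<..b powr (p - q)}\<close>. The positive part is bounded through
  \<open>E (\<bar>S\<bar>/b - \<epsilon>)\<^sub>+ powr p \<le> P (\<bar>S\<bar> \<ge> \<epsilon> b) + b powr (-p) * E (\<bar>S\<bar> powr p - b powr p)\<^sub>+\<close>, and the
  last expectation equals \<open>p / (q - p)\<close> times the integral of \<open>u powr q * P (\<bar>S\<bar> \<ge> u)\<close> over \<open>s\<close>.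
  Each probability is estimated by truncating at the level \<open>u\<close> itself, using Markov's inequality
  of order \<open>q\<close> for the truncated part and of order \<open>1\<close> for the remainder. In the variable \<open>s\<close>
  the weight \<open>u powr q\<close> exactly cancels the factor \<open>u powr (-q)\<close> of Markov's inequality, so the variance
  term becomes the integral in (b), while the other terms integrate explicitly to those in
  (a) and (e). The probability at the level \<open>\<epsilon> b\<close> is covered by (a), (c) and (d).
\<close>

section \<open>Integrals over the truncation level\<close>

lemma nn_integral_powr_Icc:
  fixes A B \<alpha> :: real
  assumes "0 < A" "A \<le> B" "\<alpha> \<noteq> -1"
  shows "(\<integral>\<^sup>+s\<in>{A..B}. ennreal (s powr \<alpha>) \<partial>lborel)
    = ennreal ((B powr (\<alpha> + 1) - A powr (\<alpha> + 1)) / (\<alpha> + 1))"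
proof -
  have "((\<lambda>s. s powr (\<alpha> + 1) / (\<alpha> + 1)) has_real_derivative s powr \<alpha>) (at s)" if "A \<le> s" for s
  proof -
    have "((\<lambda>s. s powr (\<alpha> + 1) / (\<alpha> + 1)) has_real_derivative
        ((\<alpha> + 1) * s powr (\<alpha> + 1 - 1)) / (\<alpha> + 1)) (at s)"
      using assms that by (intro DERIV_cdivide has_real_derivative_powr) auto
    moreover have "((\<alpha> + 1) * s powr (\<alpha> + 1 - 1)) / (\<alpha> + 1) = s powr \<alpha>"
      using assms by simp
    ultimately show ?thesis by metis
  qed
  then have "(\<integral>\<^sup>+s\<in>{A..B}. ennreal (s powr \<alpha>) \<partial>lborel)
      = B powr (\<alpha> + 1) / (\<alpha> + 1) - A powr (\<alpha> + 1) / (\<alpha> + 1)"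
    using assms by (intro nn_integral_FTC_Icc) (auto intro: has_field_derivative_at_within)
  then show ?thesis by (simp add: diff_divide_distrib)
qed

text \<open>Since \<open>p - q\<close> is negative, \<open>s = u powr (p - q)\<close> with
  \<open>u = s powr (1 / (p - q))\<close> is a strictly decreasing correspondence between positive
  \<open>s\<close> and positive levels \<open>u\<close>.\<close>

lemma powr_inverse_exponent_iffs:
  fixes p q b s :: real
  assumes "p < q" "b > 0" "s > 0"
  shows "s powr (1 / (p - q)) \<le> b \<longleftrightarrow> b powr (p - q) \<le> s"
    and "b \<le> s powr (1 / (p - q)) \<longleftrightarrow> s \<le> b powr (p - q)"
proof -
  have s: "s = (s powr (1 / (p - q))) powr (p - q)"
    using assms by (simp add: powr_powr)
  show "s powr (1 / (p - q)) \<le> b \<longleftrightarrow> b powr (p - q) \<le> s"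
    by (subst (2) s, use assms powr_less_mono2_neg[of "p - q" b "s powr (1 / (p - q))"]
        powr_mono2'[of "p - q" "s powr (1 / (p - q))" b] in force)
  show "b \<le> s powr (1 / (p - q)) \<longleftrightarrow> s \<le> b powr (p - q)"
    by (subst (2) s, use assms powr_less_mono2_neg[of "p - q" "s powr (1 / (p - q))" b]
        powr_mono2'[of "p - q" b "s powr (1 / (p - q))"] in force)
qed

text \<open>In the variable \<open>u\<close> the measure \<open>ds\<close> becomes
  \<open>(q - p) * u powr (p - q - 1) du\<close>, so the integral is \<open>q - p\<close> times that
  of \<open>u powr (r + p - q - 1)\<close> over \<open>{b..y}\<close>. The condition
  \<open>q - p < r\<close> makes the exponent \<open>r + p - q\<close> of the antiderivative
  positive, and the \<open>max\<close> covers the empty range \<open>y < b\<close>. The cases used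
  later are \<open>r = q\<close> and \<open>r = q - 1\<close>.\<close>

lemma nn_integral_level_powr:
  fixes p q r b y :: real
  assumes "p < q" "q - p < r" "b > 0" "y \<ge> 0"
  shows "(\<integral>\<^sup>+s\<in>{0<..b powr (p - q)}. ennreal ((s powr (1 / (p - q))) powr r)
      * indicator {s. s powr (1 / (p - q)) \<le> y} s \<partial>lborel)
    = ennreal ((q - p) / (r + p - q) * max (y powr (r + p - q) - b powr (r + p - q)) 0)"
proof (cases "b \<le> y")
  case True
  then have y: "y > 0" using assms by simp
  \<comment> \<open>As a power of \<open>s\<close> the integrand is \<open>s powr \<alpha>\<close>.
    Here \<open>\<alpha> + 1\<close> is a positive number divided by the negative
    \<open>p - q\<close>, hence nonzero.\<close>
  define \<alpha> where "\<alpha> = r / (p - q)"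
  have \<alpha>1: "\<alpha> + 1 = (r + p - q) / (p - q)"
    using assms by (simp add: \<alpha>_def field_simps)
  have le: "y powr (p - q) \<le> b powr (p - q)"
    using True assms by (intro powr_mono2') auto
  have "(\<integral>\<^sup>+s\<in>{0<..b powr (p - q)}. ennreal ((s powr (1 / (p - q))) powr r)
      * indicator {s. s powr (1 / (p - q)) \<le> y} s \<partial>lborel)
    = (\<integral>\<^sup>+s\<in>{y powr (p - q)..b powr (p - q)}. ennreal (s powr \<alpha>) \<partial>lborel)"
  proof (intro nn_integral_cong)
    fix s :: real
    \<comment> \<open>The condition that the level is at most \<open>y\<close> bounds
      \<open>s\<close> from below by \<open>y powr (p - q) > 0\<close>, which cuts off the
      singularity at 0.\<close>
    have "s \<in> {y powr (p - q)..b powr (p - q)} \<longleftrightarrow>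
        s \<in> {0<..b powr (p - q)} \<and> s powr (1 / (p - q)) \<le> y"
      using powr_inverse_exponent_iffs(1)[OF assms(1) y, of s] y
      by (cases "0 < s") (auto dest: order_trans[of "y powr (p - q)" s 0])
    then show "ennreal ((s powr (1 / (p - q))) powr r) * indicator {s. s powr (1 / (p - q)) \<le> y} s
          * indicator {0<..b powr (p - q)} s
        = ennreal (s powr \<alpha>) * indicator {y powr (p - q)..b powr (p - q)} s"
      by (auto simp: powr_powr \<alpha>_def indicator_def)
  qed
  also have "\<dots> = ennreal (((b powr (p - q)) powr (\<alpha> + 1) - (y powr (p - q)) powr (\<alpha> + 1)) / (\<alpha> + 1))"
    using y le assms \<alpha>1 by (intro nn_integral_powr_Icc) auto
  also have "((b powr (p - q)) powr (\<alpha> + 1) - (y powr (p - q)) powr (\<alpha> + 1)) / (\<alpha> + 1)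
      = (q - p) / (r + p - q) * (y powr (r + p - q) - b powr (r + p - q))"
    using assms by (simp add: \<alpha>1 powr_powr divide_simps) (simp add: algebra_simps)
  also have "y powr (r + p - q) - b powr (r + p - q) = max (y powr (r + p - q) - b powr (r + p - q)) 0"
    using True assms powr_mono2[of "r + p - q" b y] by auto
  finally show ?thesis .
next
  case False
  have "(\<integral>\<^sup>+s\<in>{0<..b powr (p - q)}. ennreal ((s powr (1 / (p - q))) powr r)
      * indicator {s. s powr (1 / (p - q)) \<le> y} s \<partial>lborel) = (\<integral>\<^sup>+s. 0 \<partial>(lborel::real measure))"
    using False powr_inverse_exponent_iffs(2)[OF assms(1,3)]
    by (intro nn_integral_cong) (fastforce simp: indicator_def)
  moreover have "max (y powr (r + p - q) - b powr (r + p - q)) 0 = 0"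
    using False assms powr_mono2[of "r + p - q" y b] by auto
  ultimately show ?thesis by simp
qed

text \<open>If \<open>x \<le> b\<close>, the integrand is at most the constant
  \<open>x powr q\<close>. Otherwise the domain splits at \<open>s = x powr (p - q)\<close>, where
  the level equals \<open>x\<close>: smaller \<open>s\<close> means a higher level, and that piece
  contributes \<open>x powr q\<close> times the length \<open>x powr (p - q)\<close>, that is
  \<open>x powr p\<close>; the levels between \<open>b\<close> and \<open>x\<close> contribute the
  integral of \<open>u powr q\<close>.\<close>

lemma nn_integral_level_min_le:
  fixes p q b x :: real
  assumes "p > 0" "p < q" "b > 0" "x \<ge> 0"
  shows "(\<integral>\<^sup>+s\<in>{0<..b powr (p - q)}. ennreal (min x (s powr (1 / (p - q))) powr q) \<partial>lborel)
    \<le> ennreal (b powr (p - q) * min x b powr q + q / p * max (x powr p - b powr p) 0)"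
proof (cases "x \<le> b")
  case True
  have "(\<integral>\<^sup>+s\<in>{0<..b powr (p - q)}. ennreal (min x (s powr (1 / (p - q))) powr q) \<partial>lborel)
      \<le> (\<integral>\<^sup>+s\<in>{0<..b powr (p - q)}. ennreal (x powr q) \<partial>lborel)"
    using assms by (intro nn_integral_mono mult_right_mono ennreal_leI powr_mono2) auto
  also have "\<dots> = ennreal (b powr (p - q) * min x b powr q)"
    using True by (simp add: nn_integral_cmult_indicator mult.commute flip: ennreal_mult)
  also have "\<dots> \<le> ennreal (b powr (p - q) * min x b powr q + q / p * max (x powr p - b powr p) 0)"
    using assms by (intro ennreal_leI) (simp add: max_def)
  finally show ?thesis .
next
  case False
  have xp: "max (x powr p - b powr p) 0 = x powr p - b powr p"
    using False assms powr_mono2[of p b x] by auto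
  have "(\<integral>\<^sup>+s\<in>{0<..b powr (p - q)}. ennreal (min x (s powr (1 / (p - q))) powr q) \<partial>lborel)
      \<le> (\<integral>\<^sup>+s. ennreal (x powr q) * indicator {0<..x powr (p - q)} s
        + ennreal ((s powr (1 / (p - q))) powr q) * indicator {s. s powr (1 / (p - q)) \<le> x} s
            * indicator {0<..b powr (p - q)} s \<partial>lborel)"
  proof (intro nn_integral_mono)
    fix s :: real
    show "ennreal (min x (s powr (1 / (p - q))) powr q) * indicator {0<..b powr (p - q)} s
      \<le> ennreal (x powr q) * indicator {0<..x powr (p - q)} s
        + ennreal ((s powr (1 / (p - q))) powr q) * indicator {s. s powr (1 / (p - q)) \<le> x} s
            * indicator {0<..b powr (p - q)} s"
      using powr_inverse_exponent_iffs(2)[of p q x s] False assms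
      by (auto simp: indicator_def min_def)
  qed
  also have "\<dots> = ennreal (x powr q) * ennreal (x powr (p - q))
      + ennreal ((q - p) / p * max (x powr p - b powr p) 0)"
    using nn_integral_level_powr[of p q q b x] assms
    by (subst nn_integral_add) (auto simp: nn_integral_cmult_indicator)
  also have "\<dots> = ennreal (x powr p + (q - p) / p * (x powr p - b powr p))"
    using assms xp False
    by (subst ennreal_mult[symmetric], simp, simp, subst ennreal_plus[symmetric])
       (auto simp flip: powr_add simp: max_def split: if_splits)
  \<comment> \<open>Writing \<open>x powr p\<close> as \<open>b powr p\<close> plus the difference
    turns the coefficient \<open>(q - p) / p\<close> into
    \<open>1 + (q - p) / p = q / p\<close>.\<close>
  also have "x powr p + (q - p) / p * (x powr p - b powr p)
      = b powr p + q / p * (x powr p - b powr p)"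
    using assms by (simp add: field_simps)
  also have "\<dots> = b powr (p - q) * min x b powr q + q / p * (x powr p - b powr p)"
    using False by (simp add: powr_add[symmetric])
  finally show ?thesis using xp by simp
qed

text \<open>The excess of \<open>x\<close> over the level \<open>u\<close> is at most
  \<open>x\<close>, and is zero unless \<open>u \<le> x\<close>. What remains is \<open>x\<close>
  times the integral of \<open>u powr (q - 1)\<close>, which is finite because \<open>p > 1\<close>.
  The last estimate is \<open>x * b powr (p - 1) \<ge> b powr p\<close> for
  \<open>x \<ge> b\<close>.\<close>

lemma nn_integral_level_excess_le:
  fixes p q b x :: real
  assumes "p > 1" "p < q" "b > 0" "x \<ge> 0"
  shows "(\<integral>\<^sup>+s\<in>{0<..b powr (p - q)}.
      ennreal ((s powr (1 / (p - q))) powr (q - 1) * max (x - s powr (1 / (p - q))) 0) \<partial>lborel)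
    \<le> ennreal ((q - p) / (p - 1) * max (x powr p - b powr p) 0)"
proof -
  have "(\<integral>\<^sup>+s\<in>{0<..b powr (p - q)}.
      ennreal ((s powr (1 / (p - q))) powr (q - 1) * max (x - s powr (1 / (p - q))) 0) \<partial>lborel)
    \<le> (\<integral>\<^sup>+s. ennreal x * (ennreal ((s powr (1 / (p - q))) powr (q - 1))
        * indicator {s. s powr (1 / (p - q)) \<le> x} s * indicator {0<..b powr (p - q)} s) \<partial>lborel)"
    using assms
    by (intro nn_integral_mono)
       (auto simp: indicator_def max_def mult.commute[of x] simp flip: ennreal_mult
         intro!: ennreal_leI mult_left_mono)
  also have "\<dots> = ennreal x * ennreal ((q - p) / (p - 1) * max (x powr (p - 1) - b powr (p - 1)) 0)"
    using nn_integral_level_powr[of p q "q - 1" b x] assms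
    by (subst nn_integral_cmult) auto
  also have "\<dots> = ennreal ((q - p) / (p - 1) * (x * max (x powr (p - 1) - b powr (p - 1)) 0))"
    using assms by (simp add: mult_ac flip: ennreal_mult)
  also have "\<dots> \<le> ennreal ((q - p) / (p - 1) * max (x powr p - b powr p) 0)"
  proof (intro ennreal_leI mult_left_mono)
    have eq: "z * z powr (p - 1) = z powr p" if "z \<ge> 0" for z :: real
      using powr_mult_base[OF that, of "p - 1"] by simp
    show "x * max (x powr (p - 1) - b powr (p - 1)) 0 \<le> max (x powr p - b powr p) 0"
    proof (cases "b \<le> x")
      case True
      have "b powr p \<le> x * b powr (p - 1)"
        using True mult_right_mono[of b x "b powr (p - 1)"] eq[of b] assms by simp
      then show ?thesis
        using True powr_mono2[of "p - 1" b x] eq[of x] assms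
        by (simp add: max_def right_diff_distrib)
    next
      case False
      then have "x powr (p - 1) \<le> b powr (p - 1)"
        using assms by (intro powr_mono2) auto
      then show ?thesis by (simp add: max_def)
    qed
  qed (use assms in auto)
  finally show ?thesis .
qed

section \<open>Tail integrals as expectations of truncated and excess variables\<close>

context prob_space
begin

text \<open>Layer-cake formula by Tonelli: both sides integrate the indicator of
  \<open>t \<in> A\<close> and \<open>t < Z \<omega>\<close> over the product space.\<close>

lemma nn_integral_tail_eq:
  fixes Z :: "'a \<Rightarrow> real"
  assumes [measurable]: "Z \<in> borel_measurable M" "A \<in> sets lborel"
  shows "(\<integral>\<^sup>+t\<in>A. ennreal \<P>(\<omega> in M. Z \<omega> > t) \<partial>lborel)
    = (\<integral>\<^sup>+\<omega>. emeasure lborel (A \<inter> {..<Z \<omega>}) \<partial>M)"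
proof -
  interpret pair_sigma_finite M lborel ..
  have "(\<integral>\<^sup>+t\<in>A. ennreal \<P>(\<omega> in M. Z \<omega> > t) \<partial>lborel)
      = (\<integral>\<^sup>+t. (\<integral>\<^sup>+\<omega>. indicator A t * indicator {..<Z \<omega>} t \<partial>M) \<partial>lborel)"
  proof (intro nn_integral_cong)
    fix t :: real
    have "(\<integral>\<^sup>+\<omega>. indicator A t * indicator {..<Z \<omega>} t \<partial>M)
        = (\<integral>\<^sup>+\<omega>. indicator A t * indicator {\<omega>\<in>space M. Z \<omega> > t} \<omega> \<partial>M)"
      by (intro nn_integral_cong) (auto simp: indicator_def)
    also have "\<dots> = indicator A t * ennreal \<P>(\<omega> in M. Z \<omega> > t)"
      by (subst nn_integral_cmult_indicator) (auto simp: emeasure_eq_measure)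
    finally show "ennreal \<P>(\<omega> in M. Z \<omega> > t) * indicator A t
        = (\<integral>\<^sup>+\<omega>. indicator A t * indicator {..<Z \<omega>} t \<partial>M)"
      by (simp add: mult.commute)
  qed
  also have "\<dots> = (\<integral>\<^sup>+\<omega>. (\<integral>\<^sup>+t. indicator A t * indicator {..<Z \<omega>} t \<partial>lborel) \<partial>M)"
    by (rule Fubini') (simp add: indicator_def, measurable)
  also have "\<dots> = (\<integral>\<^sup>+\<omega>. emeasure lborel (A \<inter> {..<Z \<omega>}) \<partial>M)"
    by (intro nn_integral_cong) (simp flip: indicator_inter_arith)
  finally show ?thesis .
qed

text \<open>For \<open>A = {0..B}\<close> the section of the layer cake at \<open>\<omega>\<close>
  has length \<open>min (Z \<omega>) B\<close>. This turns the inner integrals of (a), (b) and (c)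
  into truncated moments.\<close>

lemma set_integral_tail_eq_expectation_min:
  fixes Z :: "'a \<Rightarrow> real"
  assumes [measurable]: "Z \<in> borel_measurable M" and "\<And>\<omega>. Z \<omega> \<ge> 0" "B \<ge> 0"
  shows "(LBINT t:{0..B}. \<P>(\<omega> in M. Z \<omega> > t)) = (\<integral>\<omega>. min (Z \<omega>) B \<partial>M)"
proof -
  have [measurable]: "(\<lambda>t. \<P>(\<omega> in M. Z \<omega> > t)) \<in> borel_measurable lborel"
    by measurable
  have "ennreal (LBINT t:{0..B}. \<P>(\<omega> in M. Z \<omega> > t))
      = (\<integral>\<^sup>+t\<in>{0..B}. ennreal \<P>(\<omega> in M. Z \<omega> > t) \<partial>lborel)"
    unfolding set_lebesgue_integral_def
  proof (subst nn_integral_eq_integral[symmetric])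
    \<comment> \<open>Tail probabilities are at most 1 and the interval is bounded; integrability
      lets the Bochner integral be replaced by the nonnegative one.\<close>
    show "integrable lborel (\<lambda>t. indicat_real {0..B} t *\<^sub>R \<P>(\<omega> in M. Z \<omega> > t))"
      by (rule Bochner_Integration.integrable_bound[where f = "indicat_real {0..B}"])
         (auto intro!: integrable_real_indicator simp: indicator_def emeasure_lborel_Icc_eq)
  qed (auto intro!: nn_integral_cong simp: indicator_def)
  also have "\<dots> = (\<integral>\<^sup>+\<omega>. emeasure lborel ({0..B} \<inter> {..<Z \<omega>}) \<partial>M)"
    by (rule nn_integral_tail_eq) auto
  also have "\<dots> = (\<integral>\<^sup>+\<omega>. ennreal (min (Z \<omega>) B) \<partial>M)"
  proof (intro nn_integral_cong)
    fix \<omega>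
    have "{0..B} \<inter> {..<Z \<omega>} = (if Z \<omega> \<le> B then {0..<Z \<omega>} else {0..B})" by auto
    then show "emeasure lborel ({0..B} \<inter> {..<Z \<omega>}) = ennreal (min (Z \<omega>) B)"
      using assms by (auto simp: min_def)
  qed
  also have "\<dots> = ennreal (\<integral>\<omega>. min (Z \<omega>) B \<partial>M)"
    using assms
    by (intro nn_integral_eq_integral)
       (auto intro!: integrable_const_bound[of _ B])
  finally show ?thesis
    using assms by (subst (asm) ennreal_inj)
      (auto intro!: integral_nonneg_AE simp: set_lebesgue_integral_def)
qed

text \<open>For \<open>A = {a..}\<close> the section is \<open>{a..<Z \<omega>}\<close>. This turns
  the tail integrals of (e) into expectations of the excess of \<open>\<bar>X\<bar> powr p\<close>
  over \<open>b powr p\<close>.\<close>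

lemma nn_integral_tail_atLeast:
  fixes Z :: "'a \<Rightarrow> real"
  assumes [measurable]: "Z \<in> borel_measurable M"
  shows "(\<integral>\<^sup>+t\<in>{a..}. ennreal \<P>(\<omega> in M. Z \<omega> > t) \<partial>lborel)
    = (\<integral>\<^sup>+\<omega>. ennreal (max (Z \<omega> - a) 0) \<partial>M)"
proof -
  have "(\<integral>\<^sup>+t\<in>{a..}. ennreal \<P>(\<omega> in M. Z \<omega> > t) \<partial>lborel)
      = (\<integral>\<^sup>+\<omega>. emeasure lborel ({a..} \<inter> {..<Z \<omega>}) \<partial>M)"
    by (rule nn_integral_tail_eq) auto
  also have "\<dots> = (\<integral>\<^sup>+\<omega>. ennreal (max (Z \<omega> - a) 0) \<partial>M)"
  proof (intro nn_integral_cong)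
    fix \<omega>
    have "{a..} \<inter> {..<Z \<omega>} = {a..<Z \<omega>}" by auto
    then show "emeasure lborel ({a..} \<inter> {..<Z \<omega>}) = ennreal (max (Z \<omega> - a) 0)"
      by (simp add: max_def)
  qed
  finally show ?thesis .
qed

end

section \<open>Markov's inequality at a truncation level\<close>

lemma abs_trunc: "t > 0 \<Longrightarrow> \<bar>trunc t x\<bar> = min \<bar>x\<bar> t"
  by (auto simp: trunc_def)

lemma abs_diff_trunc: "t > 0 \<Longrightarrow> \<bar>x - trunc t x\<bar> = max (\<bar>x\<bar> - t) 0"
  by (auto simp: trunc_def)

lemma borel_measurable_trunc [measurable]: "trunc t \<in> borel_measurable borel"
  unfolding trunc_def[abs_def] by measurable

text \<open>A single row of the array. The moment bound holds at every truncation level with the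
  same \<open>\<beta>\<close> and \<open>\<xi>\<close>, so the truncation may follow the level of
  the tail that is being estimated.\<close>

locale truncated_moment_bound = prob_space M for M :: "'a measure" +
  fixes I :: "'i set" and X :: "'i \<Rightarrow> 'a \<Rightarrow> real" and q \<beta> \<xi> :: real
  assumes finite_I: "finite I"
    and integrable_X: "\<And>i. i \<in> I \<Longrightarrow> integrable M (X i)"
    and q_pos: "q > 0" and \<beta>_nonneg: "\<beta> \<ge> 0" and \<xi>_nonneg: "\<xi> \<ge> 0"
    and moment_bound: "\<And>t. t > 0 \<Longrightarrow>
      (\<integral>\<omega>. \<bar>\<Sum>i\<in>I. trunc t (X i \<omega>) - (\<integral>\<omega>'. trunc t (X i \<omega>') \<partial>M)\<bar> powr q \<partial>M)
        \<le> \<beta> * (\<Sum>i\<in>I. \<integral>\<omega>. \<bar>trunc t (X i \<omega>)\<bar> powr q \<partial>M)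
          + \<xi> * (\<Sum>i\<in>I. \<integral>\<omega>. \<bar>trunc t (X i \<omega>)\<bar>\<^sup>2 \<partial>M) powr (q / 2)"
begin

definition centred_sum :: "'a \<Rightarrow> real" where
  "centred_sum \<omega> = (\<Sum>i\<in>I. X i \<omega> - expectation (X i))"

text \<open>For \<open>u > 0\<close>, \<open>min \<bar>x\<bar> u\<close> is
  \<open>\<bar>trunc u x\<bar>\<close>. Thus \<open>qmoment\<close> and
  \<open>variance_proxy\<close> are the two sums on the right of \<open>moment_bound\<close>, and
  \<open>excess\<close> sums the first absolute moments of the remainders.\<close>

definition qmoment :: "real \<Rightarrow> real" where
  "qmoment u = (\<Sum>i\<in>I. \<integral>\<omega>. min \<bar>X i \<omega>\<bar> u powr q \<partial>M)"

definition variance_proxy :: "real \<Rightarrow> real" where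
  "variance_proxy u = (\<Sum>i\<in>I. \<integral>\<omega>. (min \<bar>X i \<omega>\<bar> u)\<^sup>2 \<partial>M)"

definition excess :: "real \<Rightarrow> real" where
  "excess u = (\<Sum>i\<in>I. \<integral>\<omega>. max (\<bar>X i \<omega>\<bar> - u) 0 \<partial>M)"

lemma measurable_X [measurable]: "i \<in> I \<Longrightarrow> X i \<in> borel_measurable M"
  using integrable_X by blast

lemma measurable_centred_sum [measurable]: "centred_sum \<in> borel_measurable M"
  unfolding centred_sum_def[abs_def] by measurable

lemma qmoment_nonneg: "qmoment u \<ge> 0"
  unfolding qmoment_def by (intro sum_nonneg integral_nonneg_AE) auto

lemma variance_proxy_nonneg: "variance_proxy u \<ge> 0"
  unfolding variance_proxy_def by (intro sum_nonneg integral_nonneg_AE) auto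

lemma excess_nonneg: "excess u \<ge> 0"
  unfolding excess_def by (intro sum_nonneg integral_nonneg_AE) auto

text \<open>The centred sum is \<open>T + R\<close>, the centred sums of the truncated variables and
  of the remainders, and one of them must reach half of the threshold. Markov's inequality of order
  \<open>q\<close> with \<open>moment_bound\<close> treats \<open>T\<close>, and the first moment
  treats \<open>R\<close>. The free \<open>\<delta>\<close> serves two uses:
  \<open>\<delta> = 1\<close> at a running level, and \<open>\<delta> = \<epsilon>\<close> at the
  level \<open>b\<close>.\<close>

lemma prob_centred_sum_le:
  assumes "\<delta> > 0" "u > 0"
  shows "\<P>(\<omega> in M. \<bar>centred_sum \<omega>\<bar> \<ge> \<delta> * u)
    \<le> (2 / \<delta>) powr q * u powr (-q) * (\<beta> * qmoment u + \<xi> * variance_proxy u powr (q / 2))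
      + 4 / \<delta> * (excess u / u)"
proof -
  define T where "T \<omega> = (\<Sum>i\<in>I. trunc u (X i \<omega>) - expectation (\<lambda>\<omega>. trunc u (X i \<omega>)))" for \<omega>
  define Y where "Y i \<omega> = X i \<omega> - trunc u (X i \<omega>)" for i \<omega>
  define R where "R \<omega> = (\<Sum>i\<in>I. Y i \<omega> - expectation (Y i))" for \<omega>
  define a where "a = \<delta> * u / 2"
  have a: "a > 0" using assms by (simp add: a_def)
  have [measurable]: "i \<in> I \<Longrightarrow> Y i \<in> borel_measurable M" for i
    unfolding Y_def[abs_def] by measurable
  have [measurable]: "T \<in> borel_measurable M" "R \<in> borel_measurable M"
    unfolding T_def[abs_def] R_def[abs_def] by measurable
  have int_trunc: "integrable M (\<lambda>\<omega>. trunc u (X i \<omega>))" if "i \<in> I" for i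
    using that assms by (intro integrable_const_bound[of _ u]) (auto simp: abs_trunc)
  have int_Y: "integrable M (Y i)" if "i \<in> I" for i
    unfolding Y_def[abs_def] using that int_trunc integrable_X by auto
  have "centred_sum \<omega> = T \<omega> + R \<omega>" for \<omega>
  proof -
    have "expectation (Y i) = expectation (X i) - expectation (\<lambda>\<omega>. trunc u (X i \<omega>))"
      if "i \<in> I" for i
      unfolding Y_def[abs_def] using that int_trunc integrable_X by auto
    then show ?thesis
      unfolding centred_sum_def T_def R_def by (simp add: Y_def flip: sum.distrib)
  qed
  then have cover: "{\<omega>\<in>space M. \<bar>centred_sum \<omega>\<bar> \<ge> \<delta> * u}
      \<subseteq> {\<omega>\<in>space M. \<bar>T \<omega>\<bar> powr q \<ge> a powr q} \<union> {\<omega>\<in>space M. \<bar>R \<omega>\<bar> \<ge> a}"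
    using a q_pos by (auto simp: a_def intro!: powr_mono2)
  \<comment> \<open>Each centred truncated variable is at most \<open>2 * u\<close> in modulus. The
    resulting bound on \<open>T\<close> makes \<open>\<bar>T\<bar> powr q\<close> integrable, as
    Markov's inequality requires.\<close>
  have T_bdd: "\<bar>T \<omega>\<bar> \<le> (\<Sum>i\<in>I. 2 * u)" for \<omega>
  proof -
    have mean: "\<bar>expectation (\<lambda>\<omega>. trunc u (X i \<omega>))\<bar> \<le> u" if "i \<in> I" for i
    proof -
      have "\<bar>expectation (\<lambda>\<omega>. trunc u (X i \<omega>))\<bar> \<le> expectation (\<lambda>\<omega>. \<bar>trunc u (X i \<omega>)\<bar>)"
        by (rule integral_abs_bound)
      also have "\<dots> \<le> expectation (\<lambda>\<omega>. u)"
        using integrable_abs[OF int_trunc[OF that]] assms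
        by (intro integral_mono) (auto simp: abs_trunc)
      finally show ?thesis by (simp add: prob_space)
    qed
    have "\<bar>trunc u (X i \<omega>) - expectation (\<lambda>\<omega>. trunc u (X i \<omega>))\<bar> \<le> 2 * u"
      if "i \<in> I" for i
    proof -
      have "\<bar>trunc u (X i \<omega>)\<bar> \<le> u" using assms by (simp add: abs_trunc)
      then show ?thesis
        using mean[OF that] by (intro order_trans[OF abs_triangle_ineq4]) linarith
    qed
    then show ?thesis
      unfolding T_def by (intro order_trans[OF sum_abs] sum_mono)
  qed
  have "integrable M (\<lambda>\<omega>. \<bar>T \<omega>\<bar> powr q)"
    using T_bdd q_pos
    by (intro integrable_const_bound[of _ "(\<Sum>i\<in>I. 2 * u) powr q"]) (auto intro!: powr_mono2)
  then have "\<P>(\<omega> in M. \<bar>T \<omega>\<bar> powr q \<ge> a powr q) \<le> expectation (\<lambda>\<omega>. \<bar>T \<omega>\<bar> powr q) / a powr q"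
    using a by (intro integral_Markov_inequality_measure[of _ _ "{}"]) auto
  also have "\<dots> \<le> (\<beta> * qmoment u + \<xi> * variance_proxy u powr (q / 2)) / a powr q"
    using moment_bound[OF assms(2)] assms(2)
    by (intro divide_right_mono) (simp_all add: T_def qmoment_def variance_proxy_def abs_trunc)
  also have "\<dots> = (2 / \<delta>) powr q * u powr (-q) * (\<beta> * qmoment u + \<xi> * variance_proxy u powr (q / 2))"
    using assms by (simp add: a_def powr_divide powr_mult powr_minus field_simps)
  finally have T: "\<P>(\<omega> in M. \<bar>T \<omega>\<bar> powr q \<ge> a powr q)
    \<le> (2 / \<delta>) powr q * u powr (-q) * (\<beta> * qmoment u + \<xi> * variance_proxy u powr (q / 2))" .
  have int_dev: "integrable M (\<lambda>\<omega>. \<bar>Y i \<omega> - expectation (Y i)\<bar>)" if "i \<in> I" for i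
    using int_Y[OF that] by auto
  have int_R: "integrable M (\<lambda>\<omega>. \<bar>R \<omega>\<bar>)"
    unfolding R_def[abs_def] using int_Y by auto
  \<comment> \<open>Centring at most doubles the first absolute moment of each remainder; division
    by \<open>a = \<delta> * u / 2\<close> then gives the constant
    \<open>4 / \<delta>\<close>.\<close>
  have "expectation (\<lambda>\<omega>. \<bar>R \<omega>\<bar>) \<le> expectation (\<lambda>\<omega>. \<Sum>i\<in>I. \<bar>Y i \<omega> - expectation (Y i)\<bar>)"
    using int_R int_dev by (intro integral_mono) (auto simp: R_def)
  also have "\<dots> = (\<Sum>i\<in>I. expectation (\<lambda>\<omega>. \<bar>Y i \<omega> - expectation (Y i)\<bar>))"
    using int_dev by (rule Bochner_Integration.integral_sum)
  also have "\<dots> \<le> (\<Sum>i\<in>I. 2 * (\<integral>\<omega>. max (\<bar>X i \<omega>\<bar> - u) 0 \<partial>M))"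
  proof (intro sum_mono)
    fix i assume i: "i \<in> I"
    have "expectation (\<lambda>\<omega>. \<bar>Y i \<omega> - expectation (Y i)\<bar>)
        \<le> expectation (\<lambda>\<omega>. \<bar>Y i \<omega>\<bar> + \<bar>expectation (Y i)\<bar>)"
      using int_dev[OF i] int_Y[OF i] by (intro integral_mono) auto
    also have "\<dots> = expectation (\<lambda>\<omega>. \<bar>Y i \<omega>\<bar>) + \<bar>expectation (Y i)\<bar>"
      using int_Y[OF i] by (simp add: prob_space)
    also have "\<dots> \<le> 2 * expectation (\<lambda>\<omega>. \<bar>Y i \<omega>\<bar>)"
      using integral_abs_bound[of M "Y i"] by simp
    finally show "expectation (\<lambda>\<omega>. \<bar>Y i \<omega> - expectation (Y i)\<bar>)
        \<le> 2 * (\<integral>\<omega>. max (\<bar>X i \<omega>\<bar> - u) 0 \<partial>M)"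
      using assms by (simp add: Y_def abs_diff_trunc)
  qed
  finally have "expectation (\<lambda>\<omega>. \<bar>R \<omega>\<bar>) \<le> 2 * excess u"
    by (simp add: excess_def sum_distrib_left)
  moreover have "\<P>(\<omega> in M. \<bar>R \<omega>\<bar> \<ge> a) \<le> expectation (\<lambda>\<omega>. \<bar>R \<omega>\<bar>) / a"
    using a int_R by (intro integral_Markov_inequality_measure[of _ _ "{}"]) auto
  ultimately have "\<P>(\<omega> in M. \<bar>R \<omega>\<bar> \<ge> a) \<le> 2 * excess u / a"
    using a by (meson divide_right_mono less_imp_le order_trans)
  also have "\<dots> = 4 / \<delta> * (excess u / u)"
    by (simp add: a_def)
  finally have R: "\<P>(\<omega> in M. \<bar>R \<omega>\<bar> \<ge> a) \<le> 4 / \<delta> * (excess u / u)" .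
  have "\<P>(\<omega> in M. \<bar>centred_sum \<omega>\<bar> \<ge> \<delta> * u)
      \<le> prob ({\<omega>\<in>space M. \<bar>T \<omega>\<bar> powr q \<ge> a powr q} \<union> {\<omega>\<in>space M. \<bar>R \<omega>\<bar> \<ge> a})"
    using cover by (intro finite_measure_mono) auto
  also have "\<dots> \<le> \<P>(\<omega> in M. \<bar>T \<omega>\<bar> powr q \<ge> a powr q) + \<P>(\<omega> in M. \<bar>R \<omega>\<bar> \<ge> a)"
    by (intro measure_Un_le) auto
  finally show ?thesis using T R by linarith
qed

end

text \<open>Tonelli carries a bound on the level integral for each fixed \<open>\<omega>\<close>
  over to expectations. A Bochner expectation of a nonnegative function never exceeds its
  nonnegative integral, as it is 0 in the non-integrable case, so only an inequality is
  claimed.\<close>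

lemma (in prob_space) nn_integral_expectation_le:
  fixes h :: "real \<Rightarrow> 'a \<Rightarrow> real" and g :: "'a \<Rightarrow> real" and D :: "real set"
  assumes [measurable]: "case_prod h \<in> borel_measurable (lborel \<Otimes>\<^sub>M M)" "D \<in> sets lborel"
    and "\<And>s \<omega>. h s \<omega> \<ge> 0"
    and "\<And>\<omega>. (\<integral>\<^sup>+s\<in>D. ennreal (h s \<omega>) \<partial>lborel) \<le> ennreal (g \<omega>)"
  shows "(\<integral>\<^sup>+s\<in>D. ennreal (\<integral>\<omega>. h s \<omega> \<partial>M) \<partial>lborel) \<le> (\<integral>\<^sup>+\<omega>. ennreal (g \<omega>) \<partial>M)"
proof -
  interpret pair_sigma_finite M lborel ..
  have "ennreal (\<integral>\<omega>. h s \<omega> \<partial>M) \<le> (\<integral>\<^sup>+\<omega>. ennreal (h s \<omega>) \<partial>M)" for s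
    using assms(3)
    by (cases "integrable M (h s)") (simp_all add: nn_integral_eq_integral not_integrable_integral_eq)
  then have "(\<integral>\<^sup>+s\<in>D. ennreal (\<integral>\<omega>. h s \<omega> \<partial>M) \<partial>lborel)
      \<le> (\<integral>\<^sup>+s. (\<integral>\<^sup>+\<omega>. ennreal (h s \<omega>) \<partial>M) * indicator D s \<partial>lborel)"
    by (intro nn_integral_mono mult_right_mono) auto
  also have "\<dots> = (\<integral>\<^sup>+s. (\<integral>\<^sup>+\<omega>. ennreal (h s \<omega>) * indicator D s \<partial>M) \<partial>lborel)"
    by (intro nn_integral_cong nn_integral_multc[symmetric]) measurable
  also have "\<dots> = (\<integral>\<^sup>+\<omega>. (\<integral>\<^sup>+s. ennreal (h s \<omega>) * indicator D s \<partial>lborel) \<partial>M)"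
    by (rule Fubini') measurable
  also have "\<dots> \<le> (\<integral>\<^sup>+\<omega>. ennreal (g \<omega>) \<partial>M)"
    using assms(4) by (intro nn_integral_mono)
  finally show ?thesis .
qed

text \<open>For fixed \<open>\<omega>\<close>, integrating \<open>u powr q\<close> over the levels
  \<open>u \<le> \<bar>Y \<omega>\<bar>\<close> gives \<open>(q - p) / p\<close> times the excess of
  the \<open>p\<close>-th power. Tonelli then replaces the indicator of these levels by a tail
  probability.\<close>

lemma (in prob_space) nn_integral_powr_excess_eq:
  fixes Y :: "'a \<Rightarrow> real"
  assumes [measurable]: "Y \<in> borel_measurable M" and "p > 0" "p < q" "b > 0"
  shows "(\<integral>\<^sup>+\<omega>. ennreal (max (\<bar>Y \<omega>\<bar> powr p - b powr p) 0) \<partial>M)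
    = ennreal (p / (q - p)) * (\<integral>\<^sup>+s\<in>{0<..b powr (p - q)}.
        ennreal ((s powr (1 / (p - q))) powr q * \<P>(\<omega> in M. \<bar>Y \<omega>\<bar> \<ge> s powr (1 / (p - q)))) \<partial>lborel)"
proof -
  interpret pair_sigma_finite M lborel ..
  let ?u = "\<lambda>s::real. s powr (1 / (p - q))"
  have "ennreal ((q - p) / p) * (\<integral>\<^sup>+\<omega>. ennreal (max (\<bar>Y \<omega>\<bar> powr p - b powr p) 0) \<partial>M)
      = (\<integral>\<^sup>+\<omega>. (\<integral>\<^sup>+s\<in>{0<..b powr (p - q)}. ennreal (?u s powr q) * indicator {s. ?u s \<le> \<bar>Y \<omega>\<bar>} s \<partial>lborel) \<partial>M)"
    using assms
    by (subst nn_integral_cmult[symmetric], simp, intro nn_integral_cong,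
        subst nn_integral_level_powr)
       (auto simp: ennreal_mult simp del: ennreal_max_0 ennreal_max_0' times_divide_eq_left)
  also have "\<dots> = (\<integral>\<^sup>+s. (\<integral>\<^sup>+\<omega>. ennreal (?u s powr q) * indicator {s. ?u s \<le> \<bar>Y \<omega>\<bar>} s
      * indicator {0<..b powr (p - q)} s \<partial>M) \<partial>lborel)"
    by (rule Fubini'[symmetric]) (simp add: indicator_def, measurable)
  also have "\<dots> = (\<integral>\<^sup>+s\<in>{0<..b powr (p - q)}.
        ennreal (?u s powr q * \<P>(\<omega> in M. \<bar>Y \<omega>\<bar> \<ge> ?u s)) \<partial>lborel)"
  proof (intro nn_integral_cong)
    fix s :: real
    have "(\<integral>\<^sup>+\<omega>. ennreal (?u s powr q) * indicator {s. ?u s \<le> \<bar>Y \<omega>\<bar>} s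
        * indicator {0<..b powr (p - q)} s \<partial>M)
      = (\<integral>\<^sup>+\<omega>. (ennreal (?u s powr q) * indicator {0<..b powr (p - q)} s)
          * indicator {\<omega>\<in>space M. \<bar>Y \<omega>\<bar> \<ge> ?u s} \<omega> \<partial>M)"
      by (intro nn_integral_cong) (auto simp: indicator_def)
    also have "\<dots> = (ennreal (?u s powr q) * indicator {0<..b powr (p - q)} s)
        * ennreal \<P>(\<omega> in M. \<bar>Y \<omega>\<bar> \<ge> ?u s)"
      by (subst nn_integral_cmult_indicator) (auto simp: emeasure_eq_measure)
    finally show "(\<integral>\<^sup>+\<omega>. ennreal (?u s powr q) * indicator {s. ?u s \<le> \<bar>Y \<omega>\<bar>} s
        * indicator {0<..b powr (p - q)} s \<partial>M)
      = ennreal (?u s powr q * \<P>(\<omega> in M. \<bar>Y \<omega>\<bar> \<ge> ?u s)) * indicator {0<..b powr (p - q)} s"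
      by (simp add: ennreal_mult mult_ac)
  qed
  finally have eq: "ennreal ((q - p) / p) * (\<integral>\<^sup>+\<omega>. ennreal (max (\<bar>Y \<omega>\<bar> powr p - b powr p) 0) \<partial>M)
    = (\<integral>\<^sup>+s\<in>{0<..b powr (p - q)}.
        ennreal (?u s powr q * \<P>(\<omega> in M. \<bar>Y \<omega>\<bar> \<ge> ?u s)) \<partial>lborel)" .
  have "ennreal (p / (q - p)) * ennreal ((q - p) / p) = 1"
    using assms by (simp flip: ennreal_mult)
  then show ?thesis
    by (simp flip: eq mult.assoc)
qed

section \<open>Level integrals of the truncated moments and of the excess\<close>

context truncated_moment_bound
begin

lemma nn_integral_qmoment_le:
  assumes "p > 0" "p < q" "b > 0"
  shows "(\<integral>\<^sup>+s\<in>{0<..b powr (p - q)}. ennreal (qmoment (s powr (1 / (p - q)))) \<partial>lborel)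
    \<le> ennreal (b powr (p - q) * qmoment b)
      + ennreal (q / p) * (\<Sum>i\<in>I. \<integral>\<^sup>+\<omega>. ennreal (max (\<bar>X i \<omega>\<bar> powr p - b powr p) 0) \<partial>M)"
proof -
  let ?u = "\<lambda>s::real. s powr (1 / (p - q))"
  have int: "integrable M (\<lambda>\<omega>. min \<bar>X i \<omega>\<bar> b powr q)" if "i \<in> I" for i
    using that assms q_pos by (intro integrable_const_bound[of _ "b powr q"]) (auto intro!: powr_mono2)
  have "(\<integral>\<^sup>+s\<in>{0<..b powr (p - q)}. ennreal (qmoment (?u s)) \<partial>lborel)
      = (\<integral>\<^sup>+s. (\<Sum>i\<in>I. ennreal (\<integral>\<omega>. min \<bar>X i \<omega>\<bar> (?u s) powr q \<partial>M)
          * indicator {0<..b powr (p - q)} s) \<partial>lborel)"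
    unfolding qmoment_def
    by (intro nn_integral_cong, subst sum_distrib_right[symmetric], subst sum_ennreal) auto
  also have "\<dots> = (\<Sum>i\<in>I. \<integral>\<^sup>+s\<in>{0<..b powr (p - q)}. ennreal (\<integral>\<omega>. min \<bar>X i \<omega>\<bar> (?u s) powr q \<partial>M) \<partial>lborel)"
    by (rule nn_integral_sum) measurable
  also have "\<dots> \<le> (\<Sum>i\<in>I. \<integral>\<^sup>+\<omega>. ennreal (b powr (p - q) * min \<bar>X i \<omega>\<bar> b powr q
      + q / p * max (\<bar>X i \<omega>\<bar> powr p - b powr p) 0) \<partial>M)"
    using assms by (intro sum_mono nn_integral_expectation_le nn_integral_level_min_le) auto
  also have "\<dots> = (\<Sum>i\<in>I. ennreal (b powr (p - q)) * ennreal (\<integral>\<omega>. min \<bar>X i \<omega>\<bar> b powr q \<partial>M)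
      + ennreal (q / p) * (\<integral>\<^sup>+\<omega>. ennreal (max (\<bar>X i \<omega>\<bar> powr p - b powr p) 0) \<partial>M))"
    using assms int
    by (intro sum.cong refl)
       (simp add: ennreal_mult nn_integral_add nn_integral_cmult nn_integral_eq_integral
          del: ennreal_max_0 ennreal_max_0' times_divide_eq_left)
  also have "\<dots> = ennreal (b powr (p - q) * qmoment b)
      + ennreal (q / p) * (\<Sum>i\<in>I. \<integral>\<^sup>+\<omega>. ennreal (max (\<bar>X i \<omega>\<bar> powr p - b powr p) 0) \<partial>M)"
    unfolding qmoment_def
    by (simp add: sum.distrib sum_distrib_left sum_nonneg ennreal_mult flip: sum_ennreal)
  finally show ?thesis .
qed

lemma nn_integral_excess_le:
  assumes "p > 1" "p < q" "b > 0"
  shows "(\<integral>\<^sup>+s\<in>{0<..b powr (p - q)}.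
      ennreal ((s powr (1 / (p - q))) powr (q - 1) * excess (s powr (1 / (p - q)))) \<partial>lborel)
    \<le> ennreal ((q - p) / (p - 1)) * (\<Sum>i\<in>I. \<integral>\<^sup>+\<omega>. ennreal (max (\<bar>X i \<omega>\<bar> powr p - b powr p) 0) \<partial>M)"
proof -
  let ?u = "\<lambda>s::real. s powr (1 / (p - q))"
  have "(\<integral>\<^sup>+s\<in>{0<..b powr (p - q)}. ennreal (?u s powr (q - 1) * excess (?u s)) \<partial>lborel)
      = (\<integral>\<^sup>+s. (\<Sum>i\<in>I. ennreal (\<integral>\<omega>. ?u s powr (q - 1) * max (\<bar>X i \<omega>\<bar> - ?u s) 0 \<partial>M)
          * indicator {0<..b powr (p - q)} s) \<partial>lborel)"
    unfolding excess_def sum_distrib_left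
    by (intro nn_integral_cong, subst sum_distrib_right[symmetric], subst sum_ennreal)
       (auto intro!: mult_nonneg_nonneg)
  also have "\<dots> = (\<Sum>i\<in>I. \<integral>\<^sup>+s\<in>{0<..b powr (p - q)}.
      ennreal (\<integral>\<omega>. ?u s powr (q - 1) * max (\<bar>X i \<omega>\<bar> - ?u s) 0 \<partial>M) \<partial>lborel)"
    by (rule nn_integral_sum) measurable
  also have "\<dots> \<le> (\<Sum>i\<in>I. \<integral>\<^sup>+\<omega>. ennreal ((q - p) / (p - 1) * max (\<bar>X i \<omega>\<bar> powr p - b powr p) 0) \<partial>M)"
    using assms by (intro sum_mono nn_integral_expectation_le nn_integral_level_excess_le) auto
  also have "\<dots> = ennreal ((q - p) / (p - 1)) * (\<Sum>i\<in>I. \<integral>\<^sup>+\<omega>. ennreal (max (\<bar>X i \<omega>\<bar> powr p - b powr p) 0) \<partial>M)"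
    using assms
    by (simp add: ennreal_mult nn_integral_cmult sum_distrib_left
        del: ennreal_max_0 ennreal_max_0' times_divide_eq_left)
  finally show ?thesis .
qed

end

section \<open>The positive part of the centred sum\<close>

context truncated_moment_bound
begin

text \<open>The tail estimate is inserted at every level. The variance integral stays unevaluated,
  because it is the one that (b) controls; the other two have explicit bounds.\<close>

lemma nn_integral_centred_sum_excess_le:
  assumes "p > 1" "p < q" "b > 0"
  defines "D \<equiv> {0<..b powr (p - q)}"
  shows "(\<integral>\<^sup>+\<omega>. ennreal (max (\<bar>centred_sum \<omega>\<bar> powr p - b powr p) 0) \<partial>M)
    \<le> ennreal (p / (q - p)) * (ennreal (2 powr q * \<beta>) * (\<integral>\<^sup>+s\<in>D. ennreal (qmoment (s powr (1 / (p - q)))) \<partial>lborel)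
      + ennreal (2 powr q * \<xi>) * (\<integral>\<^sup>+s\<in>D. ennreal (variance_proxy (s powr (1 / (p - q))) powr (q / 2)) \<partial>lborel)
      + ennreal 4 * (\<integral>\<^sup>+s\<in>D. ennreal ((s powr (1 / (p - q))) powr (q - 1) * excess (s powr (1 / (p - q)))) \<partial>lborel))"
proof -
  let ?u = "\<lambda>s::real. s powr (1 / (p - q))"
  have [measurable]: "(\<lambda>s. qmoment (?u s)) \<in> borel_measurable borel"
      "(\<lambda>s. variance_proxy (?u s)) \<in> borel_measurable borel"
      "(\<lambda>s. excess (?u s)) \<in> borel_measurable borel"
    unfolding qmoment_def variance_proxy_def excess_def by measurable
  have [measurable]: "D \<in> sets borel" by (simp add: D_def)
  have pointwise: "?u s powr q * \<P>(\<omega> in M. \<bar>centred_sum \<omega>\<bar> \<ge> ?u s)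
      \<le> 2 powr q * \<beta> * qmoment (?u s) + 2 powr q * \<xi> * variance_proxy (?u s) powr (q / 2)
        + 4 * (?u s powr (q - 1) * excess (?u s))" if "s > 0" for s
  proof -
    define u where "u = ?u s"
    have u: "u > 0" using that by (simp add: u_def)
    have "u powr q * \<P>(\<omega> in M. \<bar>centred_sum \<omega>\<bar> \<ge> u) \<le> u powr q * (2 powr q * u powr (-q) *
        (\<beta> * qmoment u + \<xi> * variance_proxy u powr (q / 2)) + 4 * (excess u / u))"
      \<comment> \<open>With \<open>\<delta> = 1\<close> the constants of the tail estimate are
        \<open>2 powr q\<close> and \<open>4\<close>.\<close>
      using prob_centred_sum_le[of 1 u] u by (intro mult_left_mono) auto
    also have "\<dots> = 2 powr q * \<beta> * qmoment u + 2 powr q * \<xi> * variance_proxy u powr (q / 2)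
        + 4 * (u powr (q - 1) * excess u)"
      using u by (simp add: powr_minus powr_diff field_simps)
    finally show ?thesis unfolding u_def .
  qed
  have "(\<integral>\<^sup>+s\<in>D. ennreal (?u s powr q * \<P>(\<omega> in M. \<bar>centred_sum \<omega>\<bar> \<ge> ?u s)) \<partial>lborel)
      \<le> (\<integral>\<^sup>+s. ennreal (2 powr q * \<beta>) * (ennreal (qmoment (?u s)) * indicator D s)
        + ennreal (2 powr q * \<xi>) * (ennreal (variance_proxy (?u s) powr (q / 2)) * indicator D s)
        + ennreal 4 * (ennreal (?u s powr (q - 1) * excess (?u s)) * indicator D s) \<partial>lborel)"
  proof (intro nn_integral_mono)
    fix s :: real
    show "ennreal (?u s powr q * \<P>(\<omega> in M. \<bar>centred_sum \<omega>\<bar> \<ge> ?u s)) * indicator D s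
        \<le> ennreal (2 powr q * \<beta>) * (ennreal (qmoment (?u s)) * indicator D s)
        + ennreal (2 powr q * \<xi>) * (ennreal (variance_proxy (?u s) powr (q / 2)) * indicator D s)
        + ennreal 4 * (ennreal (?u s powr (q - 1) * excess (?u s)) * indicator D s)"
    proof (cases "s \<in> D")
      case True
      then have "ennreal (?u s powr q * \<P>(\<omega> in M. \<bar>centred_sum \<omega>\<bar> \<ge> ?u s))
          \<le> ennreal (2 powr q * \<beta> * qmoment (?u s) + 2 powr q * \<xi> * variance_proxy (?u s) powr (q / 2)
            + 4 * (?u s powr (q - 1) * excess (?u s)))"
        by (intro ennreal_leI pointwise) (simp add: D_def)
      also have "\<dots> = ennreal (2 powr q * \<beta>) * ennreal (qmoment (?u s))
          + ennreal (2 powr q * \<xi>) * ennreal (variance_proxy (?u s) powr (q / 2))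
          + ennreal 4 * ennreal (?u s powr (q - 1) * excess (?u s))"
        using \<beta>_nonneg \<xi>_nonneg qmoment_nonneg variance_proxy_nonneg excess_nonneg
        by (subst ennreal_mult[symmetric], simp, simp)+ (simp add: ennreal_plus)
      finally show ?thesis using True by simp
    qed simp
  qed
  also have "\<dots> = ennreal (2 powr q * \<beta>) * (\<integral>\<^sup>+s\<in>D. ennreal (qmoment (?u s)) \<partial>lborel)
      + ennreal (2 powr q * \<xi>) * (\<integral>\<^sup>+s\<in>D. ennreal (variance_proxy (?u s) powr (q / 2)) \<partial>lborel)
      + ennreal 4 * (\<integral>\<^sup>+s\<in>D. ennreal (?u s powr (q - 1) * excess (?u s)) \<partial>lborel)"
    by (subst nn_integral_add, measurable)+ (subst nn_integral_cmult, measurable)+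
  finally show ?thesis
    using assms
    by (subst nn_integral_powr_excess_eq[where q = q]) (auto intro!: mult_left_mono simp: D_def)
qed

text \<open>The five summands match, in this order, the terms of (a), (c), (d), (b) and (e), still
  without the factor \<open>c n\<close>. The first coefficient has two parts since
  \<open>qmoment b\<close> arises both from the tail at \<open>\<epsilon> * b\<close> and from the
  level integral.\<close>

lemma nn_integral_positive_part_le:
  assumes "p > 1" "p < q" "b > 0" "\<epsilon> > 0"
  shows "(\<integral>\<^sup>+\<omega>. ennreal (max (\<bar>centred_sum \<omega>\<bar> / b - \<epsilon>) 0 powr p) \<partial>M)
    \<le> ennreal ((2 / \<epsilon>) powr q + 2 powr q * p / (q - p)) * ennreal (\<beta> * b powr (-q) * qmoment b)
      + ennreal ((2 / \<epsilon>) powr q) * ennreal (\<xi> * b powr (-q) * variance_proxy b powr (q / 2))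
      + ennreal (4 / \<epsilon>) * ennreal (excess b / b)
      + ennreal (2 powr q * p / (q - p)) * (ennreal (\<xi> * b powr (-p)) * (\<integral>\<^sup>+s\<in>{0<..b powr (p - q)}.
          ennreal (variance_proxy (s powr (1 / (p - q))) powr (q / 2)) \<partial>lborel))
      + ennreal (2 powr q * q / (q - p) + 4 * p / (p - 1)) * (ennreal ((1 + \<beta>) * b powr (-p)) *
          (\<Sum>i\<in>I. \<integral>\<^sup>+\<omega>. ennreal (max (\<bar>X i \<omega>\<bar> powr p - b powr p) 0) \<partial>M))"
    (is "_ \<le> ennreal (?K1 + ?K4) * ennreal ?Q + ennreal ?K1 * ennreal ?V + ennreal ?K3 * ennreal ?W
      + ennreal ?K4 * (ennreal ?x * ?J) + ennreal ?K5 * (ennreal ?y * ?G)")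
proof -
  have nonneg: "?Q \<ge> 0" "?V \<ge> 0" "?W \<ge> 0"
    using \<beta>_nonneg \<xi>_nonneg qmoment_nonneg excess_nonneg assms by auto
  \<comment> \<open>On the event the left side is at most \<open>(\<bar>S\<bar> / b) powr p\<close>,
    which is 1 plus the scaled difference of \<open>p\<close>-th powers; off the event it
    vanishes.\<close>
  have pointwise: "max (\<bar>centred_sum \<omega>\<bar> / b - \<epsilon>) 0 powr p \<le> indicat_real {\<omega>. \<bar>centred_sum \<omega>\<bar> \<ge> \<epsilon> * b} \<omega>
      + b powr (-p) * max (\<bar>centred_sum \<omega>\<bar> powr p - b powr p) 0" for \<omega>
  proof (cases "\<bar>centred_sum \<omega>\<bar> \<ge> \<epsilon> * b")
    case True
    then have "max (\<bar>centred_sum \<omega>\<bar> / b - \<epsilon>) 0 powr p \<le> (\<bar>centred_sum \<omega>\<bar> / b) powr p"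
      using assms by (intro powr_mono2) (auto simp: field_simps)
    also have "\<dots> = 1 + b powr (-p) * (\<bar>centred_sum \<omega>\<bar> powr p - b powr p)"
      using assms by (simp add: powr_divide powr_minus field_simps)
    also have "\<dots> \<le> 1 + b powr (-p) * max (\<bar>centred_sum \<omega>\<bar> powr p - b powr p) 0"
      by (intro add_left_mono mult_left_mono) auto
    finally show ?thesis using True by simp
  next
    case False
    then have "\<bar>centred_sum \<omega>\<bar> / b - \<epsilon> \<le> 0" using assms by (simp add: field_simps)
    then show ?thesis by (simp add: max_def)
  qed
  have "(\<integral>\<^sup>+\<omega>. ennreal (max (\<bar>centred_sum \<omega>\<bar> / b - \<epsilon>) 0 powr p) \<partial>M)
      \<le> (\<integral>\<^sup>+\<omega>. indicator {\<omega>\<in>space M. \<bar>centred_sum \<omega>\<bar> \<ge> \<epsilon> * b} \<omega>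
        + ennreal (b powr (-p)) * ennreal (max (\<bar>centred_sum \<omega>\<bar> powr p - b powr p) 0) \<partial>M)"
  proof (intro nn_integral_mono)
    fix \<omega> assume "\<omega> \<in> space M"
    then have "indicator {\<omega>\<in>space M. \<bar>centred_sum \<omega>\<bar> \<ge> \<epsilon> * b} \<omega>
        + ennreal (b powr (-p)) * ennreal (max (\<bar>centred_sum \<omega>\<bar> powr p - b powr p) 0)
      = ennreal (indicat_real {\<omega>. \<bar>centred_sum \<omega>\<bar> \<ge> \<epsilon> * b} \<omega>
        + b powr (-p) * max (\<bar>centred_sum \<omega>\<bar> powr p - b powr p) 0)"
      by (simp add: ennreal_plus ennreal_mult indicator_def)
    then show "ennreal (max (\<bar>centred_sum \<omega>\<bar> / b - \<epsilon>) 0 powr p)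
      \<le> indicator {\<omega>\<in>space M. \<bar>centred_sum \<omega>\<bar> \<ge> \<epsilon> * b} \<omega>
        + ennreal (b powr (-p)) * ennreal (max (\<bar>centred_sum \<omega>\<bar> powr p - b powr p) 0)"
      using ennreal_leI[OF pointwise[of \<omega>]] by simp
  qed
  also have "\<dots> = ennreal \<P>(\<omega> in M. \<bar>centred_sum \<omega>\<bar> \<ge> \<epsilon> * b)
      + ennreal (b powr (-p)) * (\<integral>\<^sup>+\<omega>. ennreal (max (\<bar>centred_sum \<omega>\<bar> powr p - b powr p) 0) \<partial>M)"
    by (subst nn_integral_add) (auto simp: nn_integral_cmult emeasure_eq_measure)
  also have "\<dots> \<le> (ennreal ?K1 * ennreal ?Q + ennreal ?K1 * ennreal ?V + ennreal ?K3 * ennreal ?W)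
      + (ennreal ?K4 * ennreal ?Q + ennreal ?K4 * (ennreal ?x * ?J) + ennreal ?K5 * (ennreal ?y * ?G))"
  proof (rule add_mono)
    have "\<P>(\<omega> in M. \<bar>centred_sum \<omega>\<bar> \<ge> \<epsilon> * b) \<le> ?K1 * ?Q + ?K1 * ?V + ?K3 * ?W"
      using prob_centred_sum_le[OF assms(4,3)] by (simp add: algebra_simps)
    then have "ennreal \<P>(\<omega> in M. \<bar>centred_sum \<omega>\<bar> \<ge> \<epsilon> * b) \<le> ennreal (?K1 * ?Q + ?K1 * ?V + ?K3 * ?W)"
      by (rule ennreal_leI)
    also have "\<dots> = ennreal ?K1 * ennreal ?Q + ennreal ?K1 * ennreal ?V + ennreal ?K3 * ennreal ?W"
      using nonneg assms
      by (simp only: ennreal_plus ennreal_mult add_nonneg_nonneg mult_nonneg_nonneg powr_ge_zero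
          divide_nonneg_pos zero_le_numeral)
    finally show "ennreal \<P>(\<omega> in M. \<bar>centred_sum \<omega>\<bar> \<ge> \<epsilon> * b)
        \<le> ennreal ?K1 * ennreal ?Q + ennreal ?K1 * ennreal ?V + ennreal ?K3 * ennreal ?W" .
  next
    have *: "ennreal r * (ennreal s * z) = ennreal (r * s) * z" if "r \<ge> 0" "s \<ge> 0" for r s z
      using that by (simp add: ennreal_mult mult.assoc)
    have "ennreal (b powr (-p)) * (\<integral>\<^sup>+\<omega>. ennreal (max (\<bar>centred_sum \<omega>\<bar> powr p - b powr p) 0) \<partial>M)
      \<le> ennreal (b powr (-p)) * (ennreal (p / (q - p)) *
          (ennreal (2 powr q * \<beta>) * (ennreal (b powr (p - q) * qmoment b) + ennreal (q / p) * ?G)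
            + ennreal (2 powr q * \<xi>) * ?J + ennreal 4 * (ennreal ((q - p) / (p - 1)) * ?G)))"
      using assms
      by (intro mult_left_mono order_trans[OF nn_integral_centred_sum_excess_le] add_mono
          nn_integral_qmoment_le nn_integral_excess_le order_refl) auto
    also have "\<dots> = ennreal (b powr (-p) * (p / (q - p)) * (2 powr q * \<beta>)) * ennreal (b powr (p - q) * qmoment b)
        + ennreal (b powr (-p) * (p / (q - p)) * (2 powr q * \<xi>)) * ?J
        + (ennreal (b powr (-p) * (p / (q - p)) * (2 powr q * \<beta>) * (q / p)) * ?G
          + ennreal (b powr (-p) * (p / (q - p)) * 4 * ((q - p) / (p - 1))) * ?G)"
      using assms \<beta>_nonneg \<xi>_nonneg
      by (simp only: distrib_left * mult.assoc mult_nonneg_nonneg powr_ge_zero divide_nonneg_pos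
          zero_le_numeral add_ac diff_gt_0_iff_gt less_imp_le zero_less_one)
    \<comment> \<open>The powers combine as
      \<open>b powr (-p) * b powr (p - q) = b powr (-q)\<close>, the normalisation in (a).\<close>
    also have "ennreal (b powr (-p) * (p / (q - p)) * (2 powr q * \<beta>)) * ennreal (b powr (p - q) * qmoment b)
        = ennreal ?K4 * ennreal ?Q"
    proof -
      have "b powr (-p) * (p / (q - p)) * (2 powr q * \<beta>) * (b powr (p - q) * qmoment b) = ?K4 * ?Q"
        using assms by (simp add: powr_minus powr_diff field_simps)
      then show ?thesis
        using assms \<beta>_nonneg nonneg qmoment_nonneg
        by (subst (1 2) ennreal_mult[symmetric]) auto
    qed
    also have "ennreal (b powr (-p) * (p / (q - p)) * (2 powr q * \<xi>)) * ?J = ennreal ?K4 * (ennreal ?x * ?J)"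
      using assms \<xi>_nonneg by (subst *) (auto simp: mult_ac)
    also have "ennreal (b powr (-p) * (p / (q - p)) * (2 powr q * \<beta>) * (q / p)) * ?G
          + ennreal (b powr (-p) * (p / (q - p)) * 4 * ((q - p) / (p - 1))) * ?G
        \<le> ennreal ?K5 * (ennreal ?y * ?G)"
    proof -
      \<comment> \<open>The truncated part brings the factor \<open>\<beta>\<close> and the
        remainder the factor 1; both are at most \<open>1 + \<beta>\<close>, the weight in
        (e).\<close>
      have "b powr (-p) * (p / (q - p)) * (2 powr q * \<beta>) * (q / p) = 2 powr q * q / (q - p) * (\<beta> * b powr (-p))"
        "b powr (-p) * (p / (q - p)) * 4 * ((q - p) / (p - 1)) = 4 * p / (p - 1) * b powr (-p)"
        using assms by simp_all
      moreover have "2 powr q * q / (q - p) * (\<beta> * b powr (-p)) \<le> 2 powr q * q / (q - p) * ?y"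
        "4 * p / (p - 1) * b powr (-p) \<le> 4 * p / (p - 1) * ?y"
        using assms \<beta>_nonneg q_pos by (intro mult_left_mono; simp add: distrib_right)+
      ultimately have "b powr (-p) * (p / (q - p)) * (2 powr q * \<beta>) * (q / p)
          + b powr (-p) * (p / (q - p)) * 4 * ((q - p) / (p - 1)) \<le> ?K5 * ?y"
        by (simp only: distrib_right add_mono)
      then have "ennreal (b powr (-p) * (p / (q - p)) * (2 powr q * \<beta>) * (q / p)
          + b powr (-p) * (p / (q - p)) * 4 * ((q - p) / (p - 1))) * ?G \<le> ennreal (?K5 * ?y) * ?G"
        by (intro mult_right_mono ennreal_leI) auto
      then show ?thesis
        using assms \<beta>_nonneg q_pos
        by (subst *) (auto simp: ennreal_plus distrib_right)
    qed
    finally show "ennreal (b powr (-p)) * (\<integral>\<^sup>+\<omega>. ennreal (max (\<bar>centred_sum \<omega>\<bar> powr p - b powr p) 0) \<partial>M)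
        \<le> ennreal ?K4 * ennreal ?Q + ennreal ?K4 * (ennreal ?x * ?J) + ennreal ?K5 * (ennreal ?y * ?G)"
      by (simp add: add_left_mono)
  qed
  also have "\<dots> = ennreal (?K1 + ?K4) * ennreal ?Q + ennreal ?K1 * ennreal ?V + ennreal ?K3 * ennreal ?W
      + ennreal ?K4 * (ennreal ?x * ?J) + ennreal ?K5 * (ennreal ?y * ?G)"
    using assms by (simp add: distrib_right ennreal_plus add_ac)
  finally show ?thesis .
qed

end

section \<open>Summation over the rows\<close>

text \<open>The sum is the supremum of its finite partial sums, and multiplication by a constant
  commutes with suprema in \<open>ennreal\<close>.\<close>

lemma infsum_cmult_ennreal:
  fixes f :: "'i \<Rightarrow> ennreal"
  shows "(\<Sum>\<^sub>\<infinity>x\<in>A. c * f x) = c * (\<Sum>\<^sub>\<infinity>x\<in>A. f x)"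
  by (simp add: nonneg_infsum_complete SUP_mult_left_ennreal flip: sum_distrib_left)

text \<open>The shape suits repeated use as an introduction rule: each application peels off the
  last summand, whose coefficient is finite as the image of a real.\<close>

lemma infsum_ennreal_finite_cmult_add:
  fixes f g :: "'i \<Rightarrow> ennreal"
  assumes "(\<Sum>\<^sub>\<infinity>x\<in>A. f x) < \<infinity>" "(\<Sum>\<^sub>\<infinity>x\<in>A. g x) < \<infinity>"
  shows "(\<Sum>\<^sub>\<infinity>x\<in>A. f x + ennreal r * g x) < \<infinity>"
proof -
  have "(\<Sum>\<^sub>\<infinity>x\<in>A. f x + ennreal r * g x) = (\<Sum>\<^sub>\<infinity>x\<in>A. f x) + (\<Sum>\<^sub>\<infinity>x\<in>A. ennreal r * g x)"
    by (intro infsum_add nonneg_summable_on_complete) auto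
  then show ?thesis
    using assms by (simp add: infsum_cmult_ennreal ennreal_mult_less_top)
qed

lemma min_powr:
  fixes x y r :: real
  assumes "x \<ge> 0" "y \<ge> 0" "r > 0"
  shows "min (x powr r) (y powr r) = min x y powr r"
  using assms powr_mono2[of r x y] powr_mono2[of r y x] by (auto simp: min_def)

text \<open>Series and possibly infinite integrals are taken in \<open>ennreal\<close>. The domain
  in (b) leaves out \<open>t = 0\<close>, which corresponds to an infinite truncation level, whereas
  \<open>0 powr x\<close> is 0.\<close>

theorem theorem2p3:
  fixes M :: "'a measure"
    and X :: "nat \<Rightarrow> nat \<Rightarrow> 'a \<Rightarrow> real"
    and p q :: real
    and \<beta> \<xi> b c :: "nat \<Rightarrow> real"
  assumes "prob_space M"
    and "p > 1"
    and "\<And>n k. 1 \<le> k \<Longrightarrow> k \<le> n \<Longrightarrow> X n k \<in> borel_measurable M"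
    and "\<And>n k. 1 \<le> k \<Longrightarrow> k \<le> n \<Longrightarrow> integrable M (\<lambda>\<omega>. \<bar>X n k \<omega>\<bar> powr p)"
    and "q > max p 2"
    and "\<And>n. n \<ge> 1 \<Longrightarrow> \<beta> n > 0"
    and "\<And>n. n \<ge> 1 \<Longrightarrow> \<xi> n > 0"
    and "\<And>n t. n \<ge> 1 \<Longrightarrow> t > 0 \<Longrightarrow>
      (\<integral>\<omega>. \<bar>\<Sum>k=1..n. trunc t (X n k \<omega>) - (\<integral>\<omega>'. trunc t (X n k \<omega>') \<partial>M)\<bar> powr q \<partial>M)
        \<le> \<beta> n * (\<Sum>k=1..n. \<integral>\<omega>. \<bar>trunc t (X n k \<omega>)\<bar> powr q \<partial>M)
          + \<xi> n * (\<Sum>k=1..n. \<integral>\<omega>. \<bar>trunc t (X n k \<omega>)\<bar>\<^sup>2 \<partial>M) powr (q / 2)"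
    and "\<And>n. n \<ge> 1 \<Longrightarrow> b n > 0"
    and "\<And>n. n \<ge> 1 \<Longrightarrow> c n > 0"
    and a: "(\<Sum>\<^sub>\<infinity>n\<in>{1..}. \<Sum>k=1..n. ennreal (\<beta> n * c n * b n powr (- q) *
        (LBINT t:{0..b n powr q}. \<P>(\<omega> in M. \<bar>X n k \<omega>\<bar> powr q > t)))) < \<infinity>"
    and b: "(\<Sum>\<^sub>\<infinity>n\<in>{1..}. ennreal (\<xi> n * c n * b n powr (- p)) *
        (\<integral>\<^sup>+t\<in>{0<..b n powr (p - q)}.
          ennreal ((\<Sum>k=1..n. LBINT s:{0..t powr (2 / (p - q))}.
            \<P>(\<omega> in M. (X n k \<omega>)\<^sup>2 > s)) powr (q / 2)) \<partial>lborel)) < \<infinity>"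
    and c: "(\<Sum>\<^sub>\<infinity>n\<in>{1..}. ennreal (\<xi> n * c n * b n powr (- q) *
        (\<Sum>k=1..n. LBINT t:{0..(b n)\<^sup>2}. \<P>(\<omega> in M. (X n k \<omega>)\<^sup>2 > t)) powr (q / 2))) < \<infinity>"
    and d: "(\<Sum>\<^sub>\<infinity>n\<in>{1..}. \<Sum>k=1..n. ennreal (c n *
        (\<integral>\<omega>. \<bar>X n k \<omega>\<bar> * indicator {\<omega>\<in>space M. \<bar>X n k \<omega>\<bar> > b n} \<omega> \<partial>M) / b n)) < \<infinity>"
    and e: "(\<Sum>\<^sub>\<infinity>n\<in>{1..}. \<Sum>k=1..n. ennreal ((1 + \<beta> n) * c n * b n powr (- p)) *
        (\<integral>\<^sup>+t\<in>{b n powr p..}. ennreal \<P>(\<omega> in M. \<bar>X n k \<omega>\<bar> powr p > t) \<partial>lborel)) < \<infinity>"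
  shows "\<forall>\<epsilon>>0. (\<Sum>\<^sub>\<infinity>n\<in>{1..}. ennreal (c n) *
      (\<integral>\<^sup>+\<omega>. ennreal (max (\<bar>\<Sum>k=1..n. X n k \<omega> - (\<integral>\<omega>'. X n k \<omega>' \<partial>M)\<bar> / b n - \<epsilon>) 0 powr p) \<partial>M)) < \<infinity>"
proof (intro allI impI)
  fix \<epsilon> :: real assume \<epsilon>: "\<epsilon> > 0"
  interpret prob_space M by fact
  note p = assms(2) and q = assms(5)
  have pq: "p < q" and q_pos: "q > 0" using q by auto
  define K1 K3 K4 K5 where "K1 = (2 / \<epsilon>) powr q" and "K3 = 4 / \<epsilon>"
    and "K4 = 2 powr q * p / (q - p)" and "K5 = 2 powr q * q / (q - p) + 4 * p / (p - 1)"
  define A where "A n = (\<Sum>k=1..n. ennreal (\<beta> n * c n * b n powr (- q) *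
        (LBINT t:{0..b n powr q}. \<P>(\<omega> in M. \<bar>X n k \<omega>\<bar> powr q > t))))" for n
  define B where "B n = ennreal (\<xi> n * c n * b n powr (- p)) *
        (\<integral>\<^sup>+t\<in>{0<..b n powr (p - q)}.
          ennreal ((\<Sum>k=1..n. LBINT s:{0..t powr (2 / (p - q))}.
            \<P>(\<omega> in M. (X n k \<omega>)\<^sup>2 > s)) powr (q / 2)) \<partial>lborel)" for n
  define C where "C n = ennreal (\<xi> n * c n * b n powr (- q) *
        (\<Sum>k=1..n. LBINT t:{0..(b n)\<^sup>2}. \<P>(\<omega> in M. (X n k \<omega>)\<^sup>2 > t)) powr (q / 2))" for n
  define D where "D n = (\<Sum>k=1..n. ennreal (c n *
        (\<integral>\<omega>. \<bar>X n k \<omega>\<bar> * indicator {\<omega>\<in>space M. \<bar>X n k \<omega>\<bar> > b n} \<omega> \<partial>M) / b n))" for n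
  define E where "E n = (\<Sum>k=1..n. ennreal ((1 + \<beta> n) * c n * b n powr (- p)) *
        (\<integral>\<^sup>+t\<in>{b n powr p..}. ennreal \<P>(\<omega> in M. \<bar>X n k \<omega>\<bar> powr p > t) \<partial>lborel))" for n
  \<comment> \<open>The leading 0 is the starting summand from which the finite sums are built up by
    \<open>infsum_ennreal_finite_cmult_add\<close>.\<close>
  have bound: "ennreal (c n) * (\<integral>\<^sup>+\<omega>. ennreal (max
        (\<bar>\<Sum>k=1..n. X n k \<omega> - (\<integral>\<omega>'. X n k \<omega>' \<partial>M)\<bar> / b n - \<epsilon>) 0 powr p) \<partial>M)
      \<le> 0 + ennreal (K1 + K4) * A n + ennreal K1 * C n + ennreal K3 * D n + ennreal K4 * B n
        + ennreal K5 * E n" if n: "n \<in> {1..}" for n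
  proof -
    have n1: "n \<ge> 1" using n by simp
    have bn: "b n > 0" and cn: "c n > 0" and \<beta>n: "\<beta> n > 0" and \<xi>n: "\<xi> n > 0"
      using n1 assms(6,7,9,10) by auto
    have meas [measurable]: "X n k \<in> borel_measurable M" if "k \<in> {1..n}" for k
      using that assms(3) by simp
    have int: "integrable M (X n k)" if k: "k \<in> {1..n}" for k
    proof (rule Bochner_Integration.integrable_bound)
      show "integrable M (\<lambda>\<omega>. 1 + \<bar>X n k \<omega>\<bar> powr p)"
        using k assms(4) by simp
      \<comment> \<open>Integrability of the \<open>p\<close>-th power gives a first moment, since
        \<open>p > 1\<close>.\<close>
      have "\<bar>x\<bar> \<le> 1 + \<bar>x\<bar> powr p" for x :: real
        using powr_mono[of 1 p "\<bar>x\<bar>"] p by (cases "\<bar>x\<bar> \<le> 1") (auto simp: add_increasing2)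
      then show "AE \<omega> in M. norm (X n k \<omega>) \<le> norm (1 + \<bar>X n k \<omega>\<bar> powr p)"
        by auto
    qed (use k in measurable)
    interpret S: truncated_moment_bound M "{1..n}" "X n" q "\<beta> n" "\<xi> n"
      using int q_pos \<beta>n \<xi>n assms(8)[OF n1] by unfold_locales auto
    have square_tail: "(\<Sum>k=1..n. LBINT t:{0..u\<^sup>2}. \<P>(\<omega> in M. (X n k \<omega>)\<^sup>2 > t)) = S.variance_proxy u"
      if "u > 0" for u
      unfolding S.variance_proxy_def
    proof (intro sum.cong refl)
      fix k assume k: "k \<in> {1..n}"
      have "min (x\<^sup>2) (u\<^sup>2) = (min \<bar>x\<bar> u)\<^sup>2" for x :: real
        using that abs_le_square_iff[of x u] by (auto simp: min_def)
      then show "(LBINT t:{0..u\<^sup>2}. \<P>(\<omega> in M. (X n k \<omega>)\<^sup>2 > t)) = (\<integral>\<omega>. (min \<bar>X n k \<omega>\<bar> u)\<^sup>2 \<partial>M)"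
        using k by (subst set_integral_tail_eq_expectation_min) auto
    qed
    have A: "A n = ennreal (c n) * ennreal (\<beta> n * b n powr (-q) * S.qmoment (b n))"
    proof -
      have "(LBINT t:{0..b n powr q}. \<P>(\<omega> in M. \<bar>X n k \<omega>\<bar> powr q > t))
          = (\<integral>\<omega>. min \<bar>X n k \<omega>\<bar> (b n) powr q \<partial>M)" if "k \<in> {1..n}" for k
        using that bn q_pos by (subst set_integral_tail_eq_expectation_min) (auto simp: min_powr)
      then have "A n = (\<Sum>k=1..n. ennreal (\<beta> n * c n * b n powr (- q) * (\<integral>\<omega>. min \<bar>X n k \<omega>\<bar> (b n) powr q \<partial>M)))"
        unfolding A_def by (intro sum.cong refl) simp
      also have "\<dots> = ennreal (\<beta> n * c n * b n powr (- q) * S.qmoment (b n))"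
        unfolding S.qmoment_def sum_distrib_left
        using \<beta>n cn by (intro sum_ennreal) auto
      also have "\<dots> = ennreal (c n) * ennreal (\<beta> n * b n powr (-q) * S.qmoment (b n))"
        using \<beta>n cn S.qmoment_nonneg by (subst ennreal_mult[symmetric]) (auto simp: mult_ac)
      finally show ?thesis .
    qed
    have C: "C n = ennreal (c n) * ennreal (\<xi> n * b n powr (-q) * S.variance_proxy (b n) powr (q / 2))"
      unfolding C_def square_tail[OF bn]
      using \<xi>n cn by (subst ennreal_mult[symmetric]) (auto simp: mult_ac)
    have B: "B n = ennreal (c n) * (ennreal (\<xi> n * b n powr (-p)) * (\<integral>\<^sup>+s\<in>{0<..b n powr (p - q)}.
          ennreal (S.variance_proxy (s powr (1 / (p - q))) powr (q / 2)) \<partial>lborel))"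
    proof -
      \<comment> \<open>The upper limit in (b) is the square of the level
        \<open>t powr (1 / (p - q))\<close>, so the inner sum is the variance proxy truncated at
        that level.\<close>
      have tail: "(\<Sum>k=1..n. LBINT s:{0..t powr (2 / (p - q))}. \<P>(\<omega> in M. (X n k \<omega>)\<^sup>2 > s))
          = S.variance_proxy (t powr (1 / (p - q)))" if "t > 0" for t
      proof -
        have "(t powr (1 / (p - q)))\<^sup>2 = t powr (2 / (p - q))"
          using that by (simp add: powr_power)
        then show ?thesis using square_tail[of "t powr (1 / (p - q))"] that by simp
      qed
      have "B n = ennreal (\<xi> n * c n * b n powr (- p)) * (\<integral>\<^sup>+s\<in>{0<..b n powr (p - q)}.
          ennreal (S.variance_proxy (s powr (1 / (p - q))) powr (q / 2)) \<partial>lborel)"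
        unfolding B_def
        by (intro arg_cong[where f = "times _"] nn_integral_cong)
           (simp add: indicator_def tail del: One_nat_def)
      also have "ennreal (\<xi> n * c n * b n powr (- p)) = ennreal (c n) * ennreal (\<xi> n * b n powr (-p))"
        using \<xi>n cn by (subst ennreal_mult[symmetric]) (auto simp: mult_ac)
      finally show ?thesis by (simp add: mult.assoc)
    qed
    \<comment> \<open>Only an inequality here: the excess of \<open>\<bar>X\<bar>\<close> over
      \<open>b n\<close> is at most \<open>\<bar>X\<bar>\<close> on the event
      \<open>\<bar>X\<bar> > b n\<close>, and zero elsewhere.\<close>
    have D: "ennreal (c n) * ennreal (S.excess (b n) / b n) \<le> D n"
    proof -
      have int_ind: "integrable M (\<lambda>\<omega>. \<bar>X n k \<omega>\<bar> * indicator {\<omega>\<in>space M. \<bar>X n k \<omega>\<bar> > b n} \<omega>)"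
        if "k \<in> {1..n}" for k
        using int[OF that] that by (intro integrable_real_mult_indicator) auto
      have "S.excess (b n)
          \<le> (\<Sum>k=1..n. \<integral>\<omega>. \<bar>X n k \<omega>\<bar> * indicator {\<omega>\<in>space M. \<bar>X n k \<omega>\<bar> > b n} \<omega> \<partial>M)"
        unfolding S.excess_def
      proof (intro sum_mono integral_mono)
        fix k assume k: "k \<in> {1..n}"
        show "integrable M (\<lambda>\<omega>. max (\<bar>X n k \<omega>\<bar> - b n) 0)"
          using int[OF k] by auto
      qed (use int_ind bn in \<open>auto simp: indicator_def\<close>)
      then have "c n * (S.excess (b n) / b n)
          \<le> c n * ((\<Sum>k=1..n. \<integral>\<omega>. \<bar>X n k \<omega>\<bar> * indicator {\<omega>\<in>space M. \<bar>X n k \<omega>\<bar> > b n} \<omega> \<partial>M) / b n)"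
        using bn cn by (intro mult_left_mono divide_right_mono) auto
      also have "\<dots> = (\<Sum>k=1..n. c n *
          (\<integral>\<omega>. \<bar>X n k \<omega>\<bar> * indicator {\<omega>\<in>space M. \<bar>X n k \<omega>\<bar> > b n} \<omega> \<partial>M) / b n)"
        by (simp add: sum_distrib_left sum_divide_distrib)
      finally have "ennreal (c n * (S.excess (b n) / b n)) \<le> ennreal (\<Sum>k=1..n. c n *
          (\<integral>\<omega>. \<bar>X n k \<omega>\<bar> * indicator {\<omega>\<in>space M. \<bar>X n k \<omega>\<bar> > b n} \<omega> \<partial>M) / b n)"
        by (rule ennreal_leI)
      also have "\<dots> = D n"
        unfolding D_def using bn cn by (intro sum_ennreal[symmetric]) auto
      finally show ?thesis
        using bn cn S.excess_nonneg by (simp flip: ennreal_mult)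
    qed
    have E: "E n = ennreal (c n) * (ennreal ((1 + \<beta> n) * b n powr (-p)) *
          (\<Sum>k=1..n. \<integral>\<^sup>+\<omega>. ennreal (max (\<bar>X n k \<omega>\<bar> powr p - b n powr p) 0) \<partial>M))"
    proof -
      have "E n = ennreal ((1 + \<beta> n) * c n * b n powr (- p)) *
          (\<Sum>k=1..n. \<integral>\<^sup>+\<omega>. ennreal (max (\<bar>X n k \<omega>\<bar> powr p - b n powr p) 0) \<partial>M)"
        unfolding E_def sum_distrib_left
        by (intro sum.cong refl arg_cong2[where f = times] nn_integral_tail_atLeast) measurable
      also have "ennreal ((1 + \<beta> n) * c n * b n powr (- p))
          = ennreal (c n) * ennreal ((1 + \<beta> n) * b n powr (-p))"
        using \<beta>n cn by (subst ennreal_mult[symmetric]) (auto simp: mult_ac)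
      finally show ?thesis by (simp add: mult.assoc)
    qed
    have "ennreal (c n) * (\<integral>\<^sup>+\<omega>. ennreal (max (\<bar>S.centred_sum \<omega>\<bar> / b n - \<epsilon>) 0 powr p) \<partial>M)
        \<le> ennreal (K1 + K4) * A n + ennreal K1 * C n
          + ennreal K3 * (ennreal (c n) * ennreal (S.excess (b n) / b n)) + ennreal K4 * B n
          + ennreal K5 * E n"
      using mult_left_mono[OF S.nn_integral_positive_part_le[OF p pq bn \<epsilon>], of "ennreal (c n)"]
      unfolding A B C E K1_def K3_def K4_def K5_def by (simp add: distrib_left mult_ac)
    also have "\<dots> \<le> ennreal (K1 + K4) * A n + ennreal K1 * C n + ennreal K3 * D n + ennreal K4 * B n
          + ennreal K5 * E n"
      by (intro add_mono mult_left_mono D order_refl) auto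
    finally show ?thesis by (simp add: S.centred_sum_def del: One_nat_def)
  qed
  have "(\<Sum>\<^sub>\<infinity>n\<in>{1..}. 0 + ennreal (K1 + K4) * A n + ennreal K1 * C n + ennreal K3 * D n
      + ennreal K4 * B n + ennreal K5 * E n) < \<infinity>"
    using a b c d e
    by (intro infsum_ennreal_finite_cmult_add) (simp_all add: A_def B_def C_def D_def E_def)
  then show "(\<Sum>\<^sub>\<infinity>n\<in>{1..}. ennreal (c n) * (\<integral>\<^sup>+\<omega>. ennreal (max
        (\<bar>\<Sum>k=1..n. X n k \<omega> - (\<integral>\<omega>'. X n k \<omega>' \<partial>M)\<bar> / b n - \<epsilon>) 0 powr p) \<partial>M)) < \<infinity>"
    \<comment> \<open>Every family in \<open>ennreal\<close> is summable, so the comparison of the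
      series is termwise.\<close>
    by (elim le_less_trans[rotated], intro infsum_mono nonneg_summable_on_complete bound) auto
qed

end
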